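(* Let $A$ be a finite set of $k \ge 2$ alternatives, let $n \ge 1$, and let $F$ be a constitution on $A$ with $n$ voters. Then $F$ satisfies IIA and Transitivity if and only if there exists a partition of $A$ into disjoint (nonempty) sets $A_1,\dots,A_r$ such that: (i) $A_1 >_F A_2 >_F \cdots >_F A_r$; (ii) for every $s$ with $|A_s| \ge 3$ there exists a voter $j$ such that $F_{A_s}$ is a dictator on voter $j$; (iii) for every $s$ with $|A_s| = 2$, the constitution $F_{A_s}$ is a non-constant function of the voters' preferences on the alternatives in $A_s$ (i.e. the social preference between the two alternatives of $A_s$ depends only on the voters' relative rankings of these two alternatives, and both outcomes occur; otherwise it is arbitrary).
   Context: A (strict) transitive preference over a finite set $A$ of alternatives is a strict linear ranking of the elements of $A$ (no ties). There are $n$ voters $1,\dots,n$; a profile is an $n$-tuple $\sigma = (\sigma(1),\dots,\sigma(n))$ of strict rankings of $A$ (all such $n$-tuples are allowed), $\sigma(i)$ being the ranking of voter $i$. A constitution is a function $F$ that associates to every profile $\sigma$ and every pair of distinct alternatives $a,b$ a strict preference between $a$ and $b$ (exactly one of "$F(\sigma)$ ranks $a$ above $b$" and "$F(\sigma)$ ranks $b$ above $a$" holds); $F(\sigma)$ denotes the resulting collection of pairwise preferences, which is not assumed a priori to be transitive. Transitivity: for every profile $\sigma$ and all three distinct alternatives $a,b,c$, if $F(\sigma)$ ranks $a$ above $b$ and $b$ above $c$, then it ranks $a$ above $c$. IIA: for every pair of alternatives $a,b$, the preference of $F(\sigma)$ between $a$ and $b$ depends only on the relative rankings of $a$ and $b$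 by the voters in $\sigma$. For sets of alternatives $B, C$, write $B >_F C$ if for every profile $\sigma$, $F(\sigma)$ ranks every alternative in $B$ above every alternative in $C$. A chain $A_1 >_F A_2 >_F \cdots >_F A_r$ means $A_s >_F A_t$ for all $s < t$. For a subset $B \subseteq A$, $F_B$ denotes $F$ restricted to the alternatives in $B$, i.e. the assignment to each profile of the pairwise preferences of $F(\sigma)$ between elements of $B$. $F_B$ is a dictator on voter $j$ if either for all profiles $\sigma$ the restriction of $F(\sigma)$ to $B$ equals the restriction of $\sigma(j)$ to $B$, or for all profiles $\sigma$ the restriction of $F(\sigma)$ to $B$ equals the reversal of the restriction of $\sigma(j)$ to $B$. *)

theory Defs
  imports Main "HOL-Library.FuncSet" "HOL-Library.Disjoint_Sets"
begin

text \<open>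
  Throughout, \<open>(a, b) \<in> R\<close> means that the (individual or social) preference \<open>R\<close> ranks \<open>a\<close>
  above \<open>b\<close>. The restriction of a preference \<open>R\<close> to a set \<open>B\<close> is \<open>Restr R B\<close>.
\<close>

definition rankings :: "'a set \<Rightarrow> 'a rel set" where
  "rankings A = {R. R \<subseteq> A \<times> A \<and> strict_linear_order_on A R}"

text \<open>The voters are \<open>1, \<dots>, n\<close>; profiles are extensional functions, that is, genuine \<open>n\<close>-tuples.\<close>

definition profiles :: "'a set \<Rightarrow> nat \<Rightarrow> (nat \<Rightarrow> 'a rel) set" where
  "profiles A n = {1..n} \<rightarrow>\<^sub>E rankings A"

text \<open>
  The pairwise social preferences are collected into a relation on \<open>A\<close>, which need not be
  transitive. Leaving out the pairs \<open>(a, a)\<close> and pairs outside \<open>A\<close> only fixes a normal form: it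
  makes equality of relations the same as agreement on all pairs of distinct alternatives.
\<close>

definition constitution :: "'a set \<Rightarrow> nat \<Rightarrow> ((nat \<Rightarrow> 'a rel) \<Rightarrow> 'a rel) \<Rightarrow> bool" where
  "constitution A n F \<longleftrightarrow>
     (\<forall>\<sigma>\<in>profiles A n. F \<sigma> \<subseteq> A \<times> A \<and> irrefl (F \<sigma>) \<and>
        (\<forall>a\<in>A. \<forall>b\<in>A. a \<noteq> b \<longrightarrow> ((a, b) \<in> F \<sigma> \<longleftrightarrow> (b, a) \<notin> F \<sigma>)))"

definition transitivity :: "'a set \<Rightarrow> nat \<Rightarrow> ((nat \<Rightarrow> 'a rel) \<Rightarrow> 'a rel) \<Rightarrow> bool" where
  "transitivity A n F \<longleftrightarrow>
     (\<forall>\<sigma>\<in>profiles A n. \<forall>a\<in>A. \<forall>b\<in>A. \<forall>c\<in>A. a \<noteq> b \<and> b \<noteq> c \<and> a \<noteq> c \<longrightarrow>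
        (a, b) \<in> F \<sigma> \<longrightarrow> (b, c) \<in> F \<sigma> \<longrightarrow> (a, c) \<in> F \<sigma>)"

text \<open>The restriction \<open>F\<^sub>B\<close>.\<close>

definition restr_const ::
    "((nat \<Rightarrow> 'a rel) \<Rightarrow> 'a rel) \<Rightarrow> 'a set \<Rightarrow> (nat \<Rightarrow> 'a rel) \<Rightarrow> 'a rel" where
  "restr_const F B \<sigma> = Restr (F \<sigma>) B"

text \<open>\<open>F\<^sub>B\<close> is a function of the voters' preferences on \<open>B\<close>.\<close>

definition depends_only_on ::
    "'a set \<Rightarrow> nat \<Rightarrow> ((nat \<Rightarrow> 'a rel) \<Rightarrow> 'a rel) \<Rightarrow> 'a set \<Rightarrow> bool" where
  "depends_only_on A n F B \<longleftrightarrow>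
     (\<forall>\<sigma>\<in>profiles A n. \<forall>\<tau>\<in>profiles A n.
        (\<forall>i\<in>{1..n}. Restr (\<sigma> i) B = Restr (\<tau> i) B) \<longrightarrow>
        restr_const F B \<sigma> = restr_const F B \<tau>)"

definition IIA :: "'a set \<Rightarrow> nat \<Rightarrow> ((nat \<Rightarrow> 'a rel) \<Rightarrow> 'a rel) \<Rightarrow> bool" where
  "IIA A n F \<longleftrightarrow> (\<forall>a\<in>A. \<forall>b\<in>A. a \<noteq> b \<longrightarrow> depends_only_on A n F {a, b})"

text \<open>\<open>B >\<^sub>F C\<close>\<close>

definition set_above ::
    "'a set \<Rightarrow> nat \<Rightarrow> ((nat \<Rightarrow> 'a rel) \<Rightarrow> 'a rel) \<Rightarrow> 'a set \<Rightarrow> 'a set \<Rightarrow> bool" where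
  "set_above A n F B C \<longleftrightarrow> (\<forall>\<sigma>\<in>profiles A n. \<forall>b\<in>B. \<forall>c\<in>C. (b, c) \<in> F \<sigma>)"

definition dictator_on ::
    "'a set \<Rightarrow> nat \<Rightarrow> ((nat \<Rightarrow> 'a rel) \<Rightarrow> 'a rel) \<Rightarrow> 'a set \<Rightarrow> nat \<Rightarrow> bool" where
  "dictator_on A n F B j \<longleftrightarrow>
     (\<forall>\<sigma>\<in>profiles A n. restr_const F B \<sigma> = Restr (\<sigma> j) B) \<or>
     (\<forall>\<sigma>\<in>profiles A n. restr_const F B \<sigma> = (Restr (\<sigma> j) B)\<inverse>)"

definition nonconstant_on ::
    "'a set \<Rightarrow> nat \<Rightarrow> ((nat \<Rightarrow> 'a rel) \<Rightarrow> 'a rel) \<Rightarrow> 'a set \<Rightarrow> bool" where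
  "nonconstant_on A n F B \<longleftrightarrow>
     (\<exists>\<sigma>\<in>profiles A n. \<exists>\<tau>\<in>profiles A n. restr_const F B \<sigma> \<noteq> restr_const F B \<tau>)"

end

theory Submission
  imports Defs "HOL-Library.Infinite_Set"
begin

text \<open>
  By IIA, \<open>F\<close> is described on each pair \<open>(a, b)\<close> by the family \<open>W a b\<close> of the coalitions \<open>S\<close> such
  that \<open>a\<close> is socially above \<open>b\<close> if exactly the members of \<open>S\<close> rank \<open>a\<close> above \<open>b\<close>. Transitivity
  says that \<open>S \<in> W a b\<close> and \<open>T \<in> W b c\<close> imply \<open>U \<in> W a c\<close> whenever \<open>S \<inter> T \<subseteq> U \<subseteq> S \<union> T\<close>. Hence
  \<open>W a b \<noteq> {}\<close> is a total preorder on the alternatives, whose classes are the required blocks.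
  Within a class all pairs are nonconstant, so each has a pivotal voter. If \<open>i\<close> is pivotal for
  \<open>(a, b)\<close> and \<open>j \<noteq> i\<close> for \<open>(b, c)\<close>, the two social preferences can be switched independently
  without touching any individual preference on \<open>(a, c)\<close>, which contradicts transitivity (Barbera's
  argument). So in a class with at least three elements all pairs have the same single pivotal voter.
\<close>

section \<open>Rankings and profiles with prescribed pairwise comparisons\<close>

lemma rankings_asym:
  assumes "R \<in> rankings A" "a \<in> A" "b \<in> A" "a \<noteq> b"
  shows "(b, a) \<in> R \<longleftrightarrow> (a, b) \<notin> R"
  using assms unfolding rankings_def strict_linear_order_on_def total_on_def irrefl_def trans_def
  by blast

lemma rankings_irrefl: "R \<in> rankings A \<Longrightarrow> (a, a) \<notin> R"
  unfolding rankings_def strict_linear_order_on_def irrefl_def by blast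

lemma rankings_trans: "R \<in> rankings A \<Longrightarrow> (a, b) \<in> R \<Longrightarrow> (b, c) \<in> R \<Longrightarrow> (a, c) \<in> R"
  unfolding rankings_def strict_linear_order_on_def trans_def by blast

lemma rankings_Restr_pair_eq:
  assumes "R \<in> rankings A" "R' \<in> rankings A" "a \<in> A" "b \<in> A" "a \<noteq> b"
    and "(a, b) \<in> R \<longleftrightarrow> (a, b) \<in> R'"
  shows "Restr R {a, b} = Restr R' {a, b}"
  using assms rankings_asym[of R A a b] rankings_asym[of R' A a b]
    rankings_irrefl[of R A] rankings_irrefl[of R' A] by auto

lemma rankings_of_key:
  fixes h :: "'a \<Rightarrow> nat"
  assumes "inj_on h A"
  shows "{(x, y). x \<in> A \<and> y \<in> A \<and> h x < h y} \<in> rankings A"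
  using assms unfolding rankings_def strict_linear_order_on_def total_on_def irrefl_def
  by (auto simp: trans_def dest: inj_onD intro: linorder_neqE_nat)

lemma ex_ranking_chain:
  assumes "finite A" "a \<in> A" "b \<in> A" "c \<in> A" "a \<noteq> b" "b \<noteq> c" "a \<noteq> c"
  obtains R where "R \<in> rankings A" "(a, b) \<in> R" "(b, c) \<in> R"
proof -
  obtain g :: "'a \<Rightarrow> nat" where g: "inj_on g A"
    using finite_imp_inj_to_nat_seg[OF assms(1)] by blast
  \<comment> \<open>A smaller key means a higher rank. The shift by 3 frees the keys 0, 1, 2, so
    overwriting three values keeps the key injective.\<close>
  define h where "h = (\<lambda>x. g x + 3)(a := 0, b := 1, c := 2)"
  have "inj_on h A"
    using g by (auto simp: inj_on_def h_def)
  then have "{(x, y). x \<in> A \<and> y \<in> A \<and> h x < h y} \<in> rankings A"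
    by (rule rankings_of_key)
  then show thesis
    by (rule that) (use assms in \<open>auto simp: h_def\<close>)
qed

lemma ex_ranking_pair:
  assumes "finite A" "a \<in> A" "b \<in> A" "a \<noteq> b"
  obtains R where "R \<in> rankings A" "(a, b) \<in> R \<longleftrightarrow> p"
proof -
  obtain g :: "'a \<Rightarrow> nat" where g: "inj_on g A"
    using finite_imp_inj_to_nat_seg[OF assms(1)] by blast
  define h where "h = (\<lambda>x. g x + 3)(a := 1, b := (if p then 2 else 0))"
  have "inj_on h A"
    using g by (auto simp: inj_on_def h_def)
  then have "{(x, y). x \<in> A \<and> y \<in> A \<and> h x < h y} \<in> rankings A"
    by (rule rankings_of_key)
  then show thesis
    by (rule that) (use assms in \<open>auto simp: h_def\<close>)
qed

text \<open>Of the eight truth patterns for \<open>p\<close>, \<open>q\<close>, \<open>r\<close>,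
  the two hypotheses exclude exactly the two cyclic ones. The other six are the six orders of
  \<open>a\<close>, \<open>b\<close>, \<open>c\<close>.\<close>

lemma ex_ranking_triple:
  assumes "finite A" "a \<in> A" "b \<in> A" "c \<in> A" "a \<noteq> b" "b \<noteq> c" "a \<noteq> c"
    and "p \<and> q \<longrightarrow> r" "r \<longrightarrow> p \<or> q"
  shows "\<exists>R\<in>rankings A. ((a, b) \<in> R \<longleftrightarrow> p) \<and> ((b, c) \<in> R \<longleftrightarrow> q) \<and> ((a, c) \<in> R \<longleftrightarrow> r)"
proof -
  have chain: "\<exists>R\<in>rankings A. (x, y) \<in> R \<and> (y, z) \<in> R \<and> (x, z) \<in> R \<and>
      (y, x) \<notin> R \<and> (z, y) \<notin> R \<and> (z, x) \<notin> R"
    if xyz: "x \<in> A" "y \<in> A" "z \<in> A" "x \<noteq> y" "y \<noteq> z" "x \<noteq> z" for x y z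
  proof -
    obtain R where "R \<in> rankings A" "(x, y) \<in> R" "(y, z) \<in> R"
      using ex_ranking_chain[OF assms(1) xyz] .
    then show ?thesis
      using rankings_trans rankings_irrefl by metis
  qed
  show ?thesis
    using chain[of a b c] chain[of a c b] chain[of b a c] chain[of b c a] chain[of c a b]
      chain[of c b a] assms(2-)
    by (cases p; cases q; cases r) (simp_all, blast+)
qed

lemma profiles_rankings: "\<sigma> \<in> profiles A n \<Longrightarrow> i \<in> {1..n} \<Longrightarrow> \<sigma> i \<in> rankings A"
  unfolding profiles_def by auto

lemma ex_profile:
  assumes "\<And>i. i \<in> {1..n} \<Longrightarrow> \<exists>R\<in>rankings A. Q i R"
  shows "\<exists>\<sigma>\<in>profiles A n. \<forall>i\<in>{1..n}. Q i (\<sigma> i)"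
proof -
  from assms obtain f where f: "\<And>i. i \<in> {1..n} \<Longrightarrow> f i \<in> rankings A \<and> Q i (f i)"
    by metis
  show ?thesis
    by (rule bexI[of _ "restrict f {1..n}"]) (use f in \<open>auto simp: profiles_def\<close>)
qed

text \<open>Pairs with one common element are linked by \<open>step\<close> up to swapping, and
  disjoint pairs \<open>a, b\<close> and \<open>c, d\<close> are linked through \<open>b, c\<close>.
  This is used both for the pivotal sets and for the sign of a dictator.\<close>

lemma const_on_pairs:
  assumes sym: "\<And>a b. a \<in> B \<Longrightarrow> b \<in> B \<Longrightarrow> a \<noteq> b \<Longrightarrow> g a b = g b a"
    and step: "\<And>a b c. a \<in> B \<Longrightarrow> b \<in> B \<Longrightarrow> c \<in> B \<Longrightarrow> a \<noteq> b \<Longrightarrow> b \<noteq> c \<Longrightarrow> a \<noteq> c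
      \<Longrightarrow> g a b = g b c"
    and "a \<in> B" "b \<in> B" "a \<noteq> b" "c \<in> B" "d \<in> B" "c \<noteq> d"
  shows "g a b = g c d"
  using assms(3-) by (metis sym step)

section \<open>Winning coalitions of a transitive IIA constitution\<close>

locale iia_transitive_constitution =
  fixes A :: "'a set" and n :: nat and F :: "(nat \<Rightarrow> 'a rel) \<Rightarrow> 'a rel"
  assumes finite_A: "finite A"
    and constitution: "constitution A n F"
    and IIA: "IIA A n F"
    and transitivity: "transitivity A n F"
begin

text \<open>Coalitions are arbitrary sets of naturals of which only the trace on
  \<open>{1..n}\<close> counts, so that complements can be written as \<open>- S\<close>.\<close>

definition W :: "'a \<Rightarrow> 'a \<Rightarrow> nat set set" where
  "W a b = {S. \<exists>\<sigma>\<in>profiles A n. (\<forall>i\<in>{1..n}. (a, b) \<in> \<sigma> i \<longleftrightarrow> i \<in> S) \<and> (a, b) \<in> F \<sigma>}"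

definition pivotal :: "'a \<Rightarrow> 'a \<Rightarrow> nat set" where
  "pivotal a b = {i. \<exists>S. (S \<in> W a b) \<noteq> (insert i S \<in> W a b)}"

lemma social_asym:
  assumes "\<sigma> \<in> profiles A n" "a \<in> A" "b \<in> A" "a \<noteq> b"
  shows "(b, a) \<in> F \<sigma> \<longleftrightarrow> (a, b) \<notin> F \<sigma>"
  using assms constitution unfolding constitution_def by blast

text \<open>By IIA the witness profile in \<open>W\<close> can be exchanged for any profile in which
  the voters compare \<open>a\<close> and \<open>b\<close> in the same way.\<close>

lemma social_iff:
  assumes \<sigma>: "\<sigma> \<in> profiles A n" and ab: "a \<in> A" "b \<in> A" "a \<noteq> b"
    and S: "\<And>i. i \<in> {1..n} \<Longrightarrow> (a, b) \<in> \<sigma> i \<longleftrightarrow> i \<in> S"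
  shows "(a, b) \<in> F \<sigma> \<longleftrightarrow> S \<in> W a b"
proof
  assume "S \<in> W a b"
  then obtain \<tau> where \<tau>: "\<tau> \<in> profiles A n" "\<forall>i\<in>{1..n}. (a, b) \<in> \<tau> i \<longleftrightarrow> i \<in> S"
      "(a, b) \<in> F \<tau>"
    unfolding W_def by blast
  have "\<forall>i\<in>{1..n}. Restr (\<sigma> i) {a, b} = Restr (\<tau> i) {a, b}"
    using \<tau>(2) S ab profiles_rankings[OF \<sigma>] profiles_rankings[OF \<tau>(1)]
    by (intro ballI rankings_Restr_pair_eq) auto
  then have "Restr (F \<sigma>) {a, b} = Restr (F \<tau>) {a, b}"
    using IIA ab \<sigma> \<tau>(1) unfolding IIA_def depends_only_on_def restr_const_def by blast
  then show "(a, b) \<in> F \<sigma>"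
    using \<tau>(3) by blast
next
  assume "(a, b) \<in> F \<sigma>"
  with \<sigma> S show "S \<in> W a b"
    unfolding W_def by (intro CollectI bexI[of _ \<sigma>]) auto
qed

lemma W_Int:
  assumes "a \<in> A" "b \<in> A" "a \<noteq> b"
    and "S \<inter> {1..n} = T \<inter> {1..n}"
  shows "S \<in> W a b \<longleftrightarrow> T \<in> W a b"
proof -
  have "(i \<in> S) = (i \<in> T)" if "i \<in> {1..n}" for i
    using assms(4) that by blast
  then show ?thesis
    unfolding W_def by simp
qed

text \<open>In any profile the voters preferring \<open>b\<close> to \<open>a\<close> form the
  complement of those preferring \<open>a\<close> to \<open>b\<close>, and society makes exactly one
  of the two choices.\<close>

lemma W_swap:
  assumes ab: "a \<in> A" "b \<in> A" "a \<noteq> b"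
  shows "S \<in> W b a \<longleftrightarrow> - S \<notin> W a b"
proof -
  have "\<exists>R\<in>rankings A. (b, a) \<in> R \<longleftrightarrow> i \<in> S" if "i \<in> {1..n}" for i
    using ex_ranking_pair[OF finite_A ab(2,1)] ab(3) by metis
  then have "\<exists>\<sigma>\<in>profiles A n. \<forall>i\<in>{1..n}. (b, a) \<in> \<sigma> i \<longleftrightarrow> i \<in> S"
    by (rule ex_profile)
  then obtain \<sigma> where \<sigma>: "\<sigma> \<in> profiles A n" "\<And>i. i \<in> {1..n} \<Longrightarrow> (b, a) \<in> \<sigma> i \<longleftrightarrow> i \<in> S"
    by blast
  have "(a, b) \<in> \<sigma> i \<longleftrightarrow> i \<in> - S" if "i \<in> {1..n}" for i
    using \<sigma>(2)[OF that] rankings_asym[OF profiles_rankings[OF \<sigma>(1) that] ab] by blast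
  then show ?thesis
    using social_iff[OF \<sigma>(1) ab] social_iff[OF \<sigma>(1) ab(2,1) _ \<sigma>(2)] social_asym[OF \<sigma>(1) ab] ab(3)
    by metis
qed

text \<open>Voter by voter, the bounds on \<open>U\<close> are the acyclicity conditions of
  \<open>ex_ranking_triple\<close>, so one profile realises \<open>S\<close>, \<open>T\<close> and
  \<open>U\<close> on the three pairs at once.\<close>

lemma W_trans:
  assumes abc: "a \<in> A" "b \<in> A" "c \<in> A" "a \<noteq> b" "b \<noteq> c" "a \<noteq> c"
    and "S \<in> W a b" "T \<in> W b c" and U: "S \<inter> T \<subseteq> U" "U \<subseteq> S \<union> T"
  shows "U \<in> W a c"
proof -
  have "\<exists>R\<in>rankings A. ((a, b) \<in> R \<longleftrightarrow> i \<in> S) \<and> ((b, c) \<in> R \<longleftrightarrow> i \<in> T) \<and>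
      ((a, c) \<in> R \<longleftrightarrow> i \<in> U)" if "i \<in> {1..n}" for i
    using U by (intro ex_ranking_triple[OF finite_A abc]) auto
  then have "\<exists>\<sigma>\<in>profiles A n. \<forall>i\<in>{1..n}. ((a, b) \<in> \<sigma> i \<longleftrightarrow> i \<in> S) \<and>
      ((b, c) \<in> \<sigma> i \<longleftrightarrow> i \<in> T) \<and> ((a, c) \<in> \<sigma> i \<longleftrightarrow> i \<in> U)"
    by (rule ex_profile)
  then obtain \<sigma> where \<sigma>: "\<sigma> \<in> profiles A n" "\<And>i. i \<in> {1..n} \<Longrightarrow> ((a, b) \<in> \<sigma> i \<longleftrightarrow> i \<in> S) \<and>
      ((b, c) \<in> \<sigma> i \<longleftrightarrow> i \<in> T) \<and> ((a, c) \<in> \<sigma> i \<longleftrightarrow> i \<in> U)"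
    by blast
  have "(a, b) \<in> F \<sigma>" "(b, c) \<in> F \<sigma>"
    using social_iff[OF \<sigma>(1), of a b S] social_iff[OF \<sigma>(1), of b c T] \<sigma>(2) assms by blast+
  then have "(a, c) \<in> F \<sigma>"
    using transitivity \<sigma>(1) abc unfolding transitivity_def by blast
  then show ?thesis
    using social_iff[OF \<sigma>(1), of a c U] \<sigma>(2) abc by blast
qed

text \<open>Complementation preserves the bounds on \<open>U\<close>, so this is transitivity along
  \<open>c\<close>, \<open>b\<close>, \<open>a\<close> read through \<open>W_swap\<close>.\<close>

lemma W_trans_neg:
  assumes abc: "a \<in> A" "b \<in> A" "c \<in> A" "a \<noteq> b" "b \<noteq> c" "a \<noteq> c"
    and "S \<notin> W a b" "T \<notin> W b c" and U: "S \<inter> T \<subseteq> U" "U \<subseteq> S \<union> T"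
  shows "U \<notin> W a c"
proof -
  have "- T \<in> W c b" "- S \<in> W b a"
    using W_swap[of b c "- T"] W_swap[of a b "- S"] assms by auto
  then have "- U \<in> W c a"
    using abc U by (intro W_trans[of c b a "- T" "- S" "- U"]) auto
  then show ?thesis
    using W_swap[of a c "- U"] abc by simp
qed

section \<open>Pivotal voters\<close>

lemma pivotal_swap:
  assumes ab: "a \<in> A" "b \<in> A" "a \<noteq> b"
  shows "pivotal a b = pivotal b a"
proof -
  have "pivotal y x \<subseteq> pivotal x y" if xy: "x \<in> A" "y \<in> A" "x \<noteq> y" for x y
  proof
    fix i assume "i \<in> pivotal y x"
    then obtain S where S: "(- S \<in> W x y) \<noteq> (- insert i S \<in> W x y)"
      unfolding pivotal_def using W_swap[OF xy] by blast
    \<comment> \<open>The choice of \<open>S\<close> rules out \<open>i \<in> S\<close>, because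
      then \<open>insert i S = S\<close>.\<close>
    then have "insert i (- insert i S) = - S"
      by (cases "i \<in> S") (auto simp: insert_absorb)
    with S show "i \<in> pivotal x y"
      unfolding pivotal_def by (auto intro!: exI[of _ "- insert i S"])
  qed
  with ab show ?thesis
    by blast
qed

lemma W_Un_non_pivotal:
  assumes "finite X" "X \<inter> pivotal a b = {}"
  shows "S \<union> X \<in> W a b \<longleftrightarrow> S \<in> W a b"
  using assms by (induction X) (auto simp: pivotal_def)

text \<open>Without pivotal voters, every coalition can be enlarged to the whole electorate without
  changing the outcome. Then \<open>W a b\<close> contains all coalitions or none, and
  \<open>W_swap\<close> makes one of the two families empty.\<close>

lemma pivotal_nonempty:
  assumes ab: "a \<in> A" "b \<in> A" "a \<noteq> b" and "W a b \<noteq> {}" "W b a \<noteq> {}"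
  shows "pivotal a b \<noteq> {}"
proof
  assume piv: "pivotal a b = {}"
  have "S \<in> W a b \<longleftrightarrow> T \<in> W a b" for S T
  proof -
    have "S \<in> W a b \<longleftrightarrow> S \<union> {1..n} \<in> W a b"
      using W_Un_non_pivotal[of "{1..n}"] piv by simp
    also have "\<dots> \<longleftrightarrow> T \<union> {1..n} \<in> W a b"
      by (rule W_Int[OF ab]) auto
    also have "\<dots> \<longleftrightarrow> T \<in> W a b"
      using W_Un_non_pivotal[of "{1..n}"] piv by simp
    finally show ?thesis .
  qed
  then show False
    using assms(4,5) W_swap[OF ab] by blast
qed

lemma pivotal_subset:
  assumes "a \<in> A" "b \<in> A" "a \<noteq> b"
  shows "pivotal a b \<subseteq> {1..n}"
proof
  fix i assume "i \<in> pivotal a b"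
  then obtain S where "(S \<in> W a b) \<noteq> (insert i S \<in> W a b)"
    unfolding pivotal_def by blast
  then have "S \<inter> {1..n} \<noteq> insert i S \<inter> {1..n}"
    using W_Int[OF assms] by blast
  then show "i \<in> {1..n}"
    by blast
qed

lemma pivotal_unique:
  assumes abc: "a \<in> A" "b \<in> A" "c \<in> A" "a \<noteq> b" "b \<noteq> c" "a \<noteq> c"
    and "i \<in> pivotal a b" "j \<in> pivotal b c"
  shows "i = j"
proof (rule ccontr)
  assume "i \<noteq> j"
  obtain S T where S: "(S \<in> W a b) \<noteq> (insert i S \<in> W a b)"
    and T: "(T \<in> W b c) \<noteq> (insert j T \<in> W b c)"
    using assms unfolding pivotal_def by blast
  txt \<open>Voter \<open>i\<close> keeps the alternatives \<open>a, b\<close> adjacent, everybody else \<open>b, c\<close>.\<close>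
  define U where "U = (if i \<in> T then insert i S else S - {i})"
  \<comment> \<open>\<open>U\<close> agrees with \<open>S'\<close> off \<open>i\<close>, and at
    \<open>i\<close> it agrees with \<open>T'\<close>, which does not vary there as
    \<open>i \<noteq> j\<close>. Hence the same \<open>U\<close> fits all four combinations.\<close>
  have compatible: "S' \<inter> T' \<subseteq> U \<and> U \<subseteq> S' \<union> T'"
    if "S' \<in> {S, insert i S}" "T' \<in> {T, insert j T}" for S' T'
    using that \<open>i \<noteq> j\<close> S T by (auto simp: U_def insert_absorb split: if_splits)
  obtain S0 S1 where "S0 \<in> {S, insert i S}" "S1 \<in> {S, insert i S}" "S0 \<notin> W a b" "S1 \<in> W a b"
    using S by blast
  moreover obtain T0 T1 where "T0 \<in> {T, insert j T}" "T1 \<in> {T, insert j T}"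
      "T0 \<notin> W b c" "T1 \<in> W b c"
    using T by blast
  \<comment> \<open>The pair \<open>S1\<close>, \<open>T1\<close> forces \<open>U\<close> into
    \<open>W a c\<close>, while \<open>S0\<close>, \<open>T0\<close> keeps it out.\<close>
  ultimately show False
    using W_trans[OF abc] W_trans_neg[OF abc] compatible by metis
qed

text \<open>Adding all voters other than \<open>j\<close> changes no outcome, and afterwards
  \<open>S\<close> and \<open>S \<inter> {j}\<close> have the same trace on
  \<open>{1..n}\<close>.\<close>

lemma W_iff_pivotal:
  assumes ab: "a \<in> A" "b \<in> A" "a \<noteq> b" and "pivotal a b \<subseteq> {j}"
  shows "S \<in> W a b \<longleftrightarrow> S \<inter> {j} \<in> W a b"
proof -
  define X where "X = {1..n} - {j}"
  have X: "finite X" "X \<inter> pivotal a b = {}"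
    using assms(4) by (auto simp: X_def)
  have "S \<in> W a b \<longleftrightarrow> S \<union> X \<in> W a b"
    using W_Un_non_pivotal[OF X] by simp
  also have "\<dots> \<longleftrightarrow> S \<inter> {j} \<union> X \<in> W a b"
    by (rule W_Int[OF ab]) (auto simp: X_def)
  also have "\<dots> \<longleftrightarrow> S \<inter> {j} \<in> W a b"
    using W_Un_non_pivotal[OF X] .
  finally show ?thesis .
qed

lemma pivotal_eq:
  assumes B: "B \<subseteq> A" "card B \<ge> 3"
    and nonconst: "\<And>a b. a \<in> B \<Longrightarrow> b \<in> B \<Longrightarrow> a \<noteq> b \<Longrightarrow> W a b \<noteq> {}"
  shows "\<exists>j\<in>{1..n}. \<forall>a\<in>B. \<forall>b\<in>B. a \<noteq> b \<longrightarrow> pivotal a b = {j}"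
proof -
  \<comment> \<open>Two nonempty sets such that each element of one equals each element of the other
    are the same singleton.\<close>
  have step: "\<exists>j. pivotal a b = {j} \<and> pivotal b c = {j}"
    if "a \<in> B" "b \<in> B" "c \<in> B" "a \<noteq> b" "b \<noteq> c" "a \<noteq> c" for a b c
  proof -
    have abc: "a \<in> A" "b \<in> A" "c \<in> A"
      using that B(1) by auto
    have "pivotal a b \<noteq> {}" "pivotal b c \<noteq> {}"
      using pivotal_nonempty nonconst abc that by metis+
    then obtain i j where "i \<in> pivotal a b" "j \<in> pivotal b c"
      by blast
    then show ?thesis
      using pivotal_unique[OF abc that(4-6)] by (intro exI[of _ i]) blast
  qed
  obtain T where "T \<subseteq> B" "card T = 3"
    using B(2) obtain_subset_with_card_n by metis
  then obtain a b c where abc: "a \<in> B" "b \<in> B" "c \<in> B" "a \<noteq> b" "b \<noteq> c" "a \<noteq> c"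
    by (auto simp: card_3_iff)
  then obtain j where j: "pivotal a b = {j}"
    using step by blast
  have "pivotal x y = {j}" if "x \<in> B" "y \<in> B" "x \<noteq> y" for x y
  proof -
    have "pivotal a b = pivotal x y"
    proof (rule const_on_pairs[where B = B and g = pivotal])
      show "pivotal u v = pivotal v u" if "u \<in> B" "v \<in> B" "u \<noteq> v" for u v
        using pivotal_swap that B(1) by blast
      show "pivotal u v = pivotal v w"
        if "u \<in> B" "v \<in> B" "w \<in> B" "u \<noteq> v" "v \<noteq> w" "u \<noteq> w" for u v w
        using step[OF that] by auto
    qed (use abc that in auto)
    with j show ?thesis
      by simp
  qed
  moreover have "j \<in> {1..n}"
    using pivotal_subset[of a b] j abc B(1) by blast
  ultimately show ?thesis
    by blast
qed

section \<open>From a common pivotal voter to a dictator\<close>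

text \<open>On each pair only \<open>j\<close> matters, so society either follows or opposes
  \<open>j\<close> there, according to the sign \<open>{j} \<in> W a b\<close>. Transitivity makes
  the sign the same on all pairs: following everywhere gives the dictator, opposing everywhere the
  reversed one.\<close>

lemma ex_dictator:
  assumes B: "B \<subseteq> A" "card B \<ge> 3"
    and nonconst: "\<And>a b. a \<in> B \<Longrightarrow> b \<in> B \<Longrightarrow> a \<noteq> b \<Longrightarrow> W a b \<noteq> {}"
  shows "\<exists>j\<in>{1..n}. dictator_on A n F B j"
proof -
  obtain j where j: "j \<in> {1..n}"
    and piv: "\<And>a b. a \<in> B \<Longrightarrow> b \<in> B \<Longrightarrow> a \<noteq> b \<Longrightarrow> pivotal a b = {j}"
    using pivotal_eq[OF assms] by blast
  have W_j: "S \<in> W a b \<longleftrightarrow> (if j \<in> S then {j} \<in> W a b else {} \<in> W a b)"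
    if "a \<in> B" "b \<in> B" "a \<noteq> b" for a b S
  proof -
    have "a \<in> A" "b \<in> A"
      using that B(1) by auto
    then have "S \<in> W a b \<longleftrightarrow> S \<inter> {j} \<in> W a b"
      using piv[OF that] that(3) by (intro W_iff_pivotal) auto
    then show ?thesis
      by simp
  qed
  have W_empty: "{} \<in> W a b \<longleftrightarrow> {j} \<notin> W a b" if ab: "a \<in> B" "b \<in> B" "a \<noteq> b" for a b
  proof -
    obtain S where "(S \<in> W a b) \<noteq> (insert j S \<in> W a b)"
      using piv[OF ab] unfolding pivotal_def by blast
    then show ?thesis
      using W_j[OF ab, of S] W_j[OF ab, of "insert j S"] by (auto split: if_splits)
  qed
  have sym: "({j} \<in> W a b) = ({j} \<in> W b a)" if ab: "a \<in> B" "b \<in> B" "a \<noteq> b" for a b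
  proof -
    have "{j} \<in> W b a \<longleftrightarrow> - {j} \<notin> W a b"
      using ab B(1) by (intro W_swap) auto
    also have "\<dots> \<longleftrightarrow> {j} \<in> W a b"
      using W_j[OF ab, of "- {j}"] W_empty[OF ab] by simp
    finally show ?thesis
      by simp
  qed
  \<comment> \<open>With opposite signs, \<open>{j}\<close> on \<open>a, b\<close> and
    \<open>{}\<close> on \<open>b, c\<close> have equal outcomes. Both \<open>{j}\<close> and
    \<open>{}\<close> lie between their intersection and union, so they get the same outcome on
    \<open>a, c\<close>, although \<open>j\<close> is decisive there.\<close>
  have step: "({j} \<in> W a b) = ({j} \<in> W b c)"
    if abc: "a \<in> B" "b \<in> B" "c \<in> B" "a \<noteq> b" "b \<noteq> c" "a \<noteq> c" for a b c
  proof (rule ccontr)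
    have A: "a \<in> A" "b \<in> A" "c \<in> A"
      using abc B(1) by auto
    assume "({j} \<in> W a b) \<noteq> ({j} \<in> W b c)"
    then consider "{j} \<in> W a b" "{} \<in> W b c" | "{j} \<notin> W a b" "{} \<notin> W b c"
      using W_empty abc by blast
    then have "({j} \<in> W a c) = ({} \<in> W a c)"
      using W_trans[OF A abc(4-6), of "{j}" "{}"] W_trans_neg[OF A abc(4-6), of "{j}" "{}"]
      by cases auto
    then show False
      using W_empty abc by blast
  qed
  have sign: "({j} \<in> W a b) = ({j} \<in> W c d)"
    if "a \<in> B" "b \<in> B" "a \<noteq> b" "c \<in> B" "d \<in> B" "c \<noteq> d" for a b c d
    using const_on_pairs[where B = B and g = "\<lambda>x y. {j} \<in> W x y", OF sym step that] .
  have F_iff: "(a, b) \<in> F \<sigma> \<longleftrightarrow> ((a, b) \<in> \<sigma> j \<longleftrightarrow> {j} \<in> W a b)"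
    if "\<sigma> \<in> profiles A n" and ab: "a \<in> B" "b \<in> B" "a \<noteq> b" for \<sigma> a b
  proof -
    have "(a, b) \<in> F \<sigma> \<longleftrightarrow> {i. (a, b) \<in> \<sigma> i} \<in> W a b"
      using that B(1) by (intro social_iff) auto
    then show ?thesis
      using W_j[OF ab, of "{i. (a, b) \<in> \<sigma> i}"] W_empty[OF ab] by simp
  qed
  have irrefl: "(a, a) \<notin> F \<sigma>" "(a, a) \<notin> \<sigma> j" if "\<sigma> \<in> profiles A n" for \<sigma> a
    using that constitution rankings_irrefl[OF profiles_rankings[OF that j]]
    unfolding constitution_def irrefl_def by auto
  have "dictator_on A n F B j"
  proof (cases "\<forall>a\<in>B. \<forall>b\<in>B. a \<noteq> b \<longrightarrow> {j} \<in> W a b")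
    case True
    have "restr_const F B \<sigma> = Restr (\<sigma> j) B" if \<sigma>: "\<sigma> \<in> profiles A n" for \<sigma>
    proof -
      have "(a, b) \<in> F \<sigma> \<longleftrightarrow> (a, b) \<in> \<sigma> j" if "a \<in> B" "b \<in> B" for a b
        using F_iff[OF \<sigma> that] True irrefl[OF \<sigma>] that by (cases "a = b") auto
      then show ?thesis
        unfolding restr_const_def by auto
    qed
    then show ?thesis
      unfolding dictator_on_def by blast
  next
    case False
    then have neg: "{j} \<notin> W a b" if "a \<in> B" "b \<in> B" "a \<noteq> b" for a b
      using sign that by blast
    have "restr_const F B \<sigma> = (Restr (\<sigma> j) B)\<inverse>" if \<sigma>: "\<sigma> \<in> profiles A n" for \<sigma>
    proof -
      have "(a, b) \<in> F \<sigma> \<longleftrightarrow> (b, a) \<in> \<sigma> j" if ab: "a \<in> B" "b \<in> B" for a b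
      proof (cases "a = b")
        case False
        have "(b, a) \<in> \<sigma> j \<longleftrightarrow> (a, b) \<notin> \<sigma> j"
          using rankings_asym[OF profiles_rankings[OF \<sigma> j]] ab False B(1) by blast
        then show ?thesis
          using F_iff[OF \<sigma> ab False] neg[OF ab False] by simp
      qed (use irrefl[OF \<sigma>] in simp)
      then show ?thesis
        unfolding restr_const_def by auto
    qed
    then show ?thesis
      unfolding dictator_on_def by blast
  qed
  with j show ?thesis
    by blast
qed

section \<open>The preorder of alternatives and its blocks\<close>

lemma W_nonempty_trans:
  assumes "a \<in> A" "b \<in> A" "c \<in> A" "a \<noteq> c"
    and "a = b \<or> W a b \<noteq> {}" "b = c \<or> W b c \<noteq> {}"
  shows "W a c \<noteq> {}"
proof (cases "a = b \<or> b = c")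
  case False
  then obtain S T where "S \<in> W a b" "T \<in> W b c"
    using assms by blast
  then have "S \<inter> T \<in> W a c"
    using False assms by (intro W_trans[of a b c S T]) auto
  then show ?thesis
    by blast
qed (use assms in auto)

lemma social_above:
  assumes "\<sigma> \<in> profiles A n" "a \<in> A" "b \<in> A" "a \<noteq> b" "W b a = {}"
  shows "(a, b) \<in> F \<sigma>"
proof -
  have "(b, a) \<in> F \<sigma> \<longleftrightarrow> {i. (b, a) \<in> \<sigma> i} \<in> W b a"
    using assms by (intro social_iff) auto
  then show ?thesis
    using assms(5) social_asym[OF assms(1-4)] by simp
qed

text \<open>A total preorder on a finite set is turned into numerical levels by counting, for each
  element, those strictly above it.\<close>

lemma ex_level:
  "\<exists>h :: 'a \<Rightarrow> nat. \<forall>a\<in>A. \<forall>b\<in>A. a \<noteq> b \<longrightarrow> (h a \<le> h b \<longleftrightarrow> W a b \<noteq> {})"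
proof -
  \<comment> \<open>If \<open>W a x\<close> is empty, \<open>x\<close> is socially above
    \<open>a\<close> in every profile; level 0 is therefore the top.\<close>
  define up where "up a = {x \<in> A. x \<noteq> a \<and> W a x = {}}" for a
  have fin: "finite (up a)" for a
    using finite_A by (simp add: up_def)
  have "card (up a) \<le> card (up b) \<longleftrightarrow> W a b \<noteq> {}" if ab: "a \<in> A" "b \<in> A" "a \<noteq> b" for a b
  proof
    assume "W a b \<noteq> {}"
    then have "up a \<subseteq> up b"
      using W_nonempty_trans[of a b] ab unfolding up_def by blast
    then show "card (up a) \<le> card (up b)"
      by (rule card_mono[OF fin])
  next
    assume le: "card (up a) \<le> card (up b)"
    show "W a b \<noteq> {}"
    proof
      assume empty: "W a b = {}"
      then have "W b a \<noteq> {}"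
        using W_swap[OF ab] by blast
      then have "up b \<subseteq> up a"
        using W_nonempty_trans[of b a] ab unfolding up_def by blast
      moreover have "b \<in> up a" "b \<notin> up b"
        using empty ab by (auto simp: up_def)
      ultimately have "card (up b) < card (up a)"
        by (intro psubset_card_mono[OF fin]) blast
      with le show False
        by simp
    qed
  qed
  then show ?thesis
    by (intro exI[of _ "\<lambda>a. card (up a)"]) simp
qed

lemma ex_block_structure:
  "\<exists>(r :: nat) (P :: nat \<Rightarrow> 'a set).
     partition_on A (P ` {1..r}) \<and> inj_on P {1..r} \<and>
     (\<forall>s\<in>{1..r}. \<forall>t\<in>{1..r}. s < t \<longrightarrow> set_above A n F (P s) (P t)) \<and>
     (\<forall>s\<in>{1..r}. card (P s) \<ge> 3 \<longrightarrow> (\<exists>j\<in>{1..n}. dictator_on A n F (P s) j)) \<and>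
     (\<forall>s\<in>{1..r}. card (P s) = 2 \<longrightarrow>
        depends_only_on A n F (P s) \<and> nonconstant_on A n F (P s))"
proof -
  obtain h :: "'a \<Rightarrow> nat" where h: "\<And>a b. a \<in> A \<Longrightarrow> b \<in> A \<Longrightarrow> a \<noteq> b \<Longrightarrow> h a \<le> h b \<longleftrightarrow> W a b \<noteq> {}"
    using ex_level by blast
  \<comment> \<open>The blocks will be the level sets of \<open>h\<close>, numbered by the
    increasing enumeration \<open>e\<close> of the levels that occur, so that top levels come
    first.\<close>
  define r where "r = card (h ` A)"
  obtain e where e: "bij_betw e {1..r} (h ` A)" "strict_mono_on {1..r} e"
  proof -
    obtain e where e: "bij_betw e {..<r} (h ` A)" "strict_mono_on {..<r} e"
      using ex_bij_betw_strict_mono_card[of "h ` A"] finite_A unfolding r_def by blast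
    \<comment> \<open>The enumeration starts at 0, whereas blocks are numbered from 1.\<close>
    have "bij_betw (\<lambda>s. s - 1) {1..r} {..<r}"
      by (rule bij_betw_byWitness[where f' = Suc]) auto
    then have "bij_betw (\<lambda>s. e (s - 1)) {1..r} (h ` A)"
      using bij_betw_trans[OF _ e(1)] by (simp add: comp_def)
    moreover have "strict_mono_on {1..r} (\<lambda>s. e (s - 1))"
    proof (rule strict_mono_onI)
      fix s t :: nat assume "s \<in> {1..r}" "t \<in> {1..r}" "s < t"
      then show "e (s - 1) < e (t - 1)"
        by (intro strict_mono_onD[OF e(2)]) auto
    qed
    ultimately show thesis
      by (rule that)
  qed
  define P where "P s = {a \<in> A. h a = e s}" for s
  have P_subset: "P s \<subseteq> A" for s
    by (auto simp: P_def)
  \<comment> \<open>Equal levels give \<open>h a \<le> h b\<close>; exchanging \<open>a\<close> and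
    \<open>b\<close> covers the other outcome.\<close>
  have nonconst: "W a b \<noteq> {}" if "a \<in> P s" "b \<in> P s" "a \<noteq> b" for a b s
    using h[of a b] that by (simp add: P_def)
  have P_nonempty: "P s \<noteq> {}" if "s \<in> {1..r}" for s
    using bij_betwE[OF e(1)] that by (force simp: P_def)
  have P_unique: "s = t" if "s \<in> {1..r}" "t \<in> {1..r}" "x \<in> P s" "x \<in> P t" for s t x
  proof -
    have "e s = e t"
      using that(3,4) unfolding P_def by simp
    then show ?thesis
      using inj_onD[OF bij_betw_imp_inj_on[OF e(1)]] that(1,2) by blast
  qed
  have "\<exists>s\<in>{1..r}. x \<in> P s" if "x \<in> A" for x
  proof -
    have "h x \<in> e ` {1..r}"
      using bij_betw_imp_surj_on[OF e(1)] that by simp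
    with that show ?thesis
      unfolding P_def by blast
  qed
  then have "\<Union> (P ` {1..r}) = A"
    using P_subset by blast
  moreover have "disjoint (P ` {1..r})"
    using P_unique unfolding disjoint_def by blast
  ultimately have "partition_on A (P ` {1..r})"
    using P_nonempty unfolding partition_on_def by blast
  moreover have "inj_on P {1..r}"
    using P_nonempty P_unique by (intro inj_onI) blast
  moreover have "set_above A n F (P s) (P t)" if st: "s \<in> {1..r}" "t \<in> {1..r}" "s < t" for s t
  proof -
    have "e s < e t"
      using e(2) st by (auto simp: strict_mono_on_def)
    then have "h b < h a" if "a \<in> P t" "b \<in> P s" for a b
      using that by (simp add: P_def)
    \<comment> \<open>The later block has the larger level, so none of its members can ever be
      placed above a member of the earlier one.\<close>
    then have "a \<noteq> b \<and> W a b = {}" if "a \<in> P t" "b \<in> P s" for a b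
      using h[of a b] P_subset that by fastforce
    then show ?thesis
      using P_subset unfolding set_above_def by (metis social_above subsetD)
  qed
  moreover have "\<exists>j\<in>{1..n}. dictator_on A n F (P s) j" if "card (P s) \<ge> 3" for s
    using ex_dictator[OF P_subset that] nonconst by blast
  moreover have "depends_only_on A n F (P s) \<and> nonconstant_on A n F (P s)"
    if card: "card (P s) = 2" for s
  proof -
    obtain a b where ab: "P s = {a, b}" "a \<noteq> b"
      using card by (auto simp: card_2_iff)
    then have A: "a \<in> A" "b \<in> A"
      using P_subset by auto
    have "W a b \<noteq> {}" "W b a \<noteq> {}"
      using nonconst ab by auto
    then obtain \<sigma> \<tau> where "\<sigma> \<in> profiles A n" "(a, b) \<in> F \<sigma>" "\<tau> \<in> profiles A n" "(b, a) \<in> F \<tau>"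
      unfolding W_def by blast
    then have "nonconstant_on A n F {a, b}"
      using social_asym[of \<tau> a b] A ab(2)
      unfolding nonconstant_on_def restr_const_def by blast
    then show ?thesis
      using IIA A ab unfolding IIA_def by simp
  qed
  ultimately show ?thesis
    by blast
qed

end

section \<open>The converse: block structures give IIA and transitivity\<close>

lemma dictator_on_imp_depends_only_on:
  assumes "dictator_on A n F B j" "j \<in> {1..n}" "B' \<subseteq> B"
  shows "depends_only_on A n F B'"
proof -
  have restr: "restr_const F B' \<sigma> = Restr (restr_const F B \<sigma>) B'"
      "Restr (\<sigma> j) B' = Restr (Restr (\<sigma> j) B) B'"
      "(Restr (\<sigma> j) B')\<inverse> = Restr ((Restr (\<sigma> j) B)\<inverse>) B'" for \<sigma>
    using assms(3) by (auto simp: restr_const_def)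
  show ?thesis
    using assms(1,2) restr unfolding dictator_on_def depends_only_on_def by metis
qed

text \<open>A pair split between blocks has a constant outcome, and a pair inside a block is
  governed by a dictator or by the two-element condition. For transitivity, social preference never
  leads back to an earlier block, so the only critical case is a triple inside a single
  block.\<close>

lemma block_structure_imp_IIA_transitivity:
  fixes P :: "nat \<Rightarrow> 'a set"
  assumes const: "constitution A n F" and part: "partition_on A (P ` {1..r})"
    and above: "\<And>s t. s \<in> {1..r} \<Longrightarrow> t \<in> {1..r} \<Longrightarrow> s < t \<Longrightarrow> set_above A n F (P s) (P t)"
    and dict: "\<And>s. s \<in> {1..r} \<Longrightarrow> card (P s) \<ge> 3 \<Longrightarrow> \<exists>j\<in>{1..n}. dictator_on A n F (P s) j"
    and pair: "\<And>s. s \<in> {1..r} \<Longrightarrow> card (P s) = 2 \<Longrightarrow> depends_only_on A n F (P s)"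
    and fin: "finite A"
  shows "IIA A n F \<and> transitivity A n F"
proof
  have asym: "(b, a) \<notin> F \<sigma>" if "\<sigma> \<in> profiles A n" "(a, b) \<in> F \<sigma>" for \<sigma> a b
  proof -
    have "a \<in> A" "b \<in> A" "a \<noteq> b"
      using const that unfolding constitution_def irrefl_def by blast+
    then show ?thesis
      using const that unfolding constitution_def by blast
  qed
  have irrefl: "(a, a) \<notin> F \<sigma>" if "\<sigma> \<in> profiles A n" for \<sigma> a
    using const that unfolding constitution_def irrefl_def by blast
  have block: "\<exists>s\<in>{1..r}. x \<in> P s" if "x \<in> A" for x
    using partition_onD1[OF part] that by blast
  have finP: "finite (P s)" if "s \<in> {1..r}" for s
    using partition_onD1[OF part] fin that by (auto intro: finite_subset)
  show "IIA A n F"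
    unfolding IIA_def
  proof (intro ballI impI)
    fix a b assume ab: "a \<in> A" "b \<in> A" "a \<noteq> b"
    obtain s t where s: "s \<in> {1..r}" "a \<in> P s" and t: "t \<in> {1..r}" "b \<in> P t"
      using block ab by blast
    consider "s = t" | "s < t" | "t < s"
      by linarith
    then show "depends_only_on A n F {a, b}"
    proof cases
      case 1
      have sub: "{a, b} \<subseteq> P s" "card {a, b} = 2"
        using s t 1 ab by auto
      then have "2 \<le> card (P s)"
        using card_mono[OF finP[OF s(1)] sub(1)] by simp
      then consider "card (P s) = 2" | "card (P s) \<ge> 3"
        by linarith
      then show ?thesis
      proof cases
        case 1
        then have "{a, b} = P s"
          using card_subset_eq[OF finP[OF s(1)] sub(1)] sub(2) by simp
        then show ?thesis
          using pair[OF s(1) 1] by simp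
      next
        case 2
        then show ?thesis
          using dict[OF s(1)] dictator_on_imp_depends_only_on sub(1) by metis
      qed
    next
      case 2
      then have "restr_const F {a, b} \<sigma> = {(a, b)}" if "\<sigma> \<in> profiles A n" for \<sigma>
        using above[of s t] asym irrefl s t that unfolding set_above_def restr_const_def by blast
      then show ?thesis
        unfolding depends_only_on_def by simp
    next
      case 3
      then have "restr_const F {a, b} \<sigma> = {(b, a)}" if "\<sigma> \<in> profiles A n" for \<sigma>
        using above[of t s] asym irrefl s t that unfolding set_above_def restr_const_def by blast
      then show ?thesis
        unfolding depends_only_on_def by simp
    qed
  qed
  show "transitivity A n F"
    unfolding transitivity_def
  proof (intro ballI impI)
    fix \<sigma> a b c
    assume \<sigma>: "\<sigma> \<in> profiles A n" and abc: "a \<in> A" "b \<in> A" "c \<in> A"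
      and ne: "a \<noteq> b \<and> b \<noteq> c \<and> a \<noteq> c" and F: "(a, b) \<in> F \<sigma>" "(b, c) \<in> F \<sigma>"
    have mono: "s \<le> t" if "s \<in> {1..r}" "t \<in> {1..r}" "x \<in> P s" "y \<in> P t" "(x, y) \<in> F \<sigma>" for s t x y
      using above[of t s] asym[OF \<sigma>] \<sigma> that unfolding set_above_def by (meson not_le)
    obtain s t u where s: "s \<in> {1..r}" "a \<in> P s" and t: "t \<in> {1..r}" "b \<in> P t"
      and u: "u \<in> {1..r}" "c \<in> P u"
      using block abc by metis
    have le: "s \<le> t" "t \<le> u"
      using mono s t u F by blast+
    show "(a, c) \<in> F \<sigma>"
    proof (cases "s < u")
      case True
      then show ?thesis
        using above[of s u] s u \<sigma> unfolding set_above_def by blast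
    next
      case False
      \<comment> \<open>From \<open>s \<le> t \<le> u\<close> and not \<open>s < u\<close>, all
        three alternatives share a block. Being distinct, they force a dictator there.\<close>
      then have "s = t" "s = u"
        using le by auto
      then have in_P: "{a, b, c} \<subseteq> P s"
        using s t u by simp
      moreover have "card {a, b, c} = 3"
        using ne by simp
      ultimately have "card (P s) \<ge> 3"
        using card_mono[OF finP[OF s(1)]] by metis
      then obtain j where j: "j \<in> {1..n}" "dictator_on A n F (P s) j"
        using dict[OF s(1)] by blast
      note trans = rankings_trans[OF profiles_rankings[OF \<sigma> j(1)]]
      consider "Restr (F \<sigma>) (P s) = Restr (\<sigma> j) (P s)" | "Restr (F \<sigma>) (P s) = (Restr (\<sigma> j) (P s))\<inverse>"
        using j(2) \<sigma> unfolding dictator_on_def restr_const_def by blast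
      then show ?thesis
      proof cases
        case 1
        then show ?thesis
          using F in_P trans[of a b c] by blast
      next
        \<comment> \<open>For a reversed dictator, transitivity of \<open>\<sigma> j\<close> is
          applied in the opposite direction, along \<open>c\<close>, \<open>b\<close>,
          \<open>a\<close>.\<close>
        case 2
        then show ?thesis
          using F in_P trans[of c b a] by blast
      qed
    qed
  qed
qed

theorem theorem1p3:
  fixes A :: "'a set" and n :: nat and F :: "(nat \<Rightarrow> 'a rel) \<Rightarrow> 'a rel"
  assumes "finite A" and "card A \<ge> 2" and "n \<ge> 1" and "constitution A n F"
  shows "IIA A n F \<and> transitivity A n F \<longleftrightarrow>
    (\<exists>(r :: nat) (P :: nat \<Rightarrow> 'a set).
       partition_on A (P ` {1..r}) \<and> inj_on P {1..r} \<and>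
       (\<forall>s\<in>{1..r}. \<forall>t\<in>{1..r}. s < t \<longrightarrow> set_above A n F (P s) (P t)) \<and>
       (\<forall>s\<in>{1..r}. card (P s) \<ge> 3 \<longrightarrow> (\<exists>j\<in>{1..n}. dictator_on A n F (P s) j)) \<and>
       (\<forall>s\<in>{1..r}. card (P s) = 2 \<longrightarrow>
          depends_only_on A n F (P s) \<and> nonconstant_on A n F (P s)))"
    (is "?L \<longleftrightarrow> ?R")
proof
  assume ?L
  then interpret iia_transitive_constitution A n F
    using assms by unfold_locales auto
  show ?R
    by (rule ex_block_structure)
next
  assume ?R
  then obtain r :: nat and P :: "nat \<Rightarrow> 'a set" where
    "partition_on A (P ` {1..r})"
    "\<forall>s\<in>{1..r}. \<forall>t\<in>{1..r}. s < t \<longrightarrow> set_above A n F (P s) (P t)"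
    "\<forall>s\<in>{1..r}. card (P s) \<ge> 3 \<longrightarrow> (\<exists>j\<in>{1..n}. dictator_on A n F (P s) j)"
    "\<forall>s\<in>{1..r}. card (P s) = 2 \<longrightarrow> depends_only_on A n F (P s) \<and> nonconstant_on A n F (P s)"
    by (elim exE conjE)
  then show ?L
    by (intro block_structure_imp_IIA_transitivity[where P = P and r = r] assms(1,4)) simp_all
qed

end
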